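(* For any real $t$ with $1\le t\le 10$, the set $\{n\ge1:\ \mathscr{M}(n)<t\}$ has URI-density equal to $\log_{10} t$.
   Context: For a positive real number $x$, the mantissa $\mathscr{M}(x)$ is the unique real number in $[1,10)$ such that $x=\mathscr{M}(x)\,10^k$ for some integer $k$. A URI-set is a random set $\mathbf{E}$ of positive integers such that each integer $n\ge1$ belongs to $\mathbf{E}$ with probability $1/n$, the events $(n\in\mathbf{E})$, $n\ge1$, being independent. Almost surely $\mathbf{E}$ is infinite, and its ordered elements are denoted $N_1=1<N_2<\cdots<N_k<\cdots$. A set $A$ of positive integers has URI-density $\alpha$ if, almost surely, $\frac1n\sum_{k=1}^n\mathbf{1}_A(N_k)\to\alpha$ as $n\to\infty$, where $\mathbf{1}_A$ is the indicator function of $A$. *)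

theory Defs
  imports "HOL-Probability.Probability"
begin

definition mantissa :: "real \<Rightarrow> real" where
  "mantissa x = (THE m. 1 \<le> m \<and> m < 10 \<and> (\<exists>k::int. x = m * 10 powi k))"

text \<open>Measurability of the events \<open>n \<in> E\<close> is part of \<^const>\<open>prob_space.indep_events\<close>.\<close>

locale URI_set = prob_space M for M :: "'w measure" +
  fixes E :: "'w \<Rightarrow> nat set"
  assumes positive: "\<omega> \<in> space M \<Longrightarrow> E \<omega> \<subseteq> {1..}"
    and prob_mem: "n \<ge> 1 \<Longrightarrow> prob {\<omega> \<in> space M. n \<in> E \<omega>} = 1 / real n"
    and indep_mem: "indep_events (\<lambda>n. {\<omega> \<in> space M. n \<in> E \<omega>}) {1..}"

text \<open>
  \<open>nth_elem S k\<close> is the \<open>k\<close>-th smallest element of \<open>S\<close>, counting from \<open>1\<close>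
  (\<^const>\<open>enumerate\<close> counts from \<open>0\<close>). It is meaningful for infinite \<open>S\<close>, which is the
  almost sure case for a URI-set.
\<close>

definition nth_elem :: "nat set \<Rightarrow> nat \<Rightarrow> nat" where
  "nth_elem S k = enumerate S (k - 1)"

text \<open>
  The defining conditions of a URI-set determine its law, so this does not depend on the
  choice of the URI-set \<open>E\<close>; a statement about URI-density is made for an arbitrary one.
\<close>

definition has_URI_density :: "'w measure \<Rightarrow> ('w \<Rightarrow> nat set) \<Rightarrow> nat set \<Rightarrow> real \<Rightarrow> bool" where
  "has_URI_density M E A \<alpha> \<longleftrightarrow>
     (AE \<omega> in M. (\<lambda>n. (1 / real n) * (\<Sum>k=1..n. indicator A (nth_elem (E \<omega>) k))) \<longlonglongrightarrow> \<alpha>)"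

end

theory Submission
  imports Defs "HOL-Real_Asymp.Real_Asymp"
begin

text \<open>
  Write \<open>C\<^sub>B(n)\<close> for the number of elements of \<open>\<^bold>E \<inter> B\<close> below \<open>n\<close>. Averaging
  the indicator of \<open>B\<close> over the first elements of \<open>\<^bold>E\<close> amounts to evaluating the quotient
  of \<open>C\<^sub>B\<close> by the count of all elements of \<open>\<^bold>E\<close> at the successive elements of
  \<open>\<^bold>E\<close> (\<open>average_nth_elem_tendsto\<close>). So it is enough to know the almost sure growth of
  both counts, and each of them grows like its mean.

  The mean of \<open>C\<^sub>B(n)\<close> is the sum of \<open>1/m\<close> over the \<open>m \<in> B\<close> below \<open>n\<close>. When \<open>B\<close> is the
  set of integers with mantissa less than \<open>t\<close>, its part in the decade from \<open>10\<^sup>j\<close>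
  to \<open>10\<^sup>j\<^sup>+\<^sup>1\<close> is the set of integers of the interval from \<open>10\<^sup>j\<close> to
  \<open>t 10\<^sup>j\<close>, whose reciprocals add up to nearly \<open>ln t\<close>
  (\<open>decade_reciprocal_sum_tendsto\<close>). Hence the mean of \<open>C\<^sub>B(n)\<close> is asymptotically
  \<open>ln t\<close> times the number \<open>log 10 n\<close> of decades. The case \<open>t = 10\<close> gives all positive integers,
  and the quotient of the two counts tends to \<open>ln t / ln 10\<close>.

  That a count follows its mean is a strong law of large numbers for independent events
  (\<open>AE_card_div_log_tendsto\<close>). The variance of a count of independent events is at most its
  mean, so Chebyshev's inequality and the Borel-Cantelli lemma give convergence along a
  sequence of thresholds on which the mean grows like \<open>k\<^sup>4\<close>. Since \<open>(k+1)\<^sup>4\<close> and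
  \<open>k\<^sup>4\<close> are asymptotically equal and the count is monotone, convergence extends to all \<open>n\<close>.
\<close>

section \<open>Counts of independent events\<close>

text \<open>
  The centred indicators of independent events are orthogonal, so the variance is the sum of the
  individual variances \<open>p - p\<^sup>2 \<le> p\<close>.
\<close>
lemma (in prob_space) variance_count_le:
  assumes indep: "indep_events A I" and "finite I"
  shows "variance (\<lambda>\<omega>. \<Sum>i\<in>I. indicator (A i) \<omega>) \<le> (\<Sum>i\<in>I. prob (A i))"
proof -
  define X where "X i \<omega> = indicator (A i) \<omega> - prob (A i)" for i \<omega>
  have ev [measurable]: "A i \<in> events" if "i \<in> I" for i
    using indep that by (auto simp: indep_events_def)
  have prod: "X i \<omega> * X j \<omega> = indicator (A i \<inter> A j) \<omega> - prob (A i) * indicator (A j) \<omega>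
      - prob (A j) * indicator (A i) \<omega> + prob (A i) * prob (A j)" for i j \<omega>
    by (simp add: X_def indicator_inter_arith algebra_simps)
  have int: "integrable M (\<lambda>\<omega>. X i \<omega> * X j \<omega>)" if "i \<in> I" "j \<in> I" for i j
    unfolding prod using that by (auto simp: emeasure_eq_measure)
  have E: "expectation (\<lambda>\<omega>. X i \<omega> * X j \<omega>) = prob (A i \<inter> A j) - prob (A i) * prob (A j)"
    if "i \<in> I" "j \<in> I" for i j
    unfolding prod using that by (simp add: emeasure_eq_measure prob_space)
  have off: "expectation (\<lambda>\<omega>. X i \<omega> * X j \<omega>) = 0" if "i \<in> I" "j \<in> I" "i \<noteq> j" for i j
  proof -
    have "prob (\<Inter>l\<in>{i, j}. A l) = (\<Prod>l\<in>{i, j}. prob (A l))"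
      using indep that by (intro indep_events_def[THEN iffD1, THEN conjunct2, rule_format]) auto
    then show ?thesis
      using that by (simp add: E)
  qed
  have "variance (\<lambda>\<omega>. \<Sum>i\<in>I. indicator (A i) \<omega>) = expectation (\<lambda>\<omega>. (\<Sum>i\<in>I. X i \<omega>)\<^sup>2)"
    by (simp add: X_def sum_subtractf emeasure_eq_measure)
  also have "\<dots> = expectation (\<lambda>\<omega>. \<Sum>i\<in>I. \<Sum>j\<in>I. X i \<omega> * X j \<omega>)"
    by (simp add: power2_eq_square sum_product)
  also have "\<dots> = (\<Sum>i\<in>I. \<Sum>j\<in>I. expectation (\<lambda>\<omega>. X i \<omega> * X j \<omega>))"
    by (simp add: int)
  also have "\<dots> = (\<Sum>i\<in>I. expectation (\<lambda>\<omega>. X i \<omega> * X i \<omega>))"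
  proof (rule sum.cong[OF refl])
    fix i assume "i \<in> I"
    then show "(\<Sum>j\<in>I. expectation (\<lambda>\<omega>. X i \<omega> * X j \<omega>)) = expectation (\<lambda>\<omega>. X i \<omega> * X i \<omega>)"
      using \<open>finite I\<close> by (subst sum.remove[of _ i]) (auto intro!: sum.neutral off)
  qed
  also have "\<dots> \<le> (\<Sum>i\<in>I. prob (A i))"
    by (intro sum_mono) (simp add: E)
  finally show ?thesis .
qed

text \<open>
  A count with mean of order \<open>k\<^sup>4\<close> has variance of order at most \<open>k\<^sup>4\<close>, so it deviates from its mean
  by \<open>k\<^sup>3\<close> with probability of order at most \<open>k\<^sup>4 / k\<^sup>6 = 1 / k\<^sup>2\<close>, which is summable.
  Since \<open>k\<^sup>3\<close> is negligible against \<open>k\<^sup>4\<close>, a single use of the Borel-Cantelli lemma suffices; a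
  deviation proportional to the mean would require one for each \<open>\<epsilon> > 0\<close>.
\<close>
lemma (in prob_space) AE_count_div_power4_tendsto:
  fixes J :: "nat \<Rightarrow> 'i set"
  assumes indep: "indep_events A I" and J: "\<And>k. finite (J k)" "\<And>k. J k \<subseteq> I"
    and mean: "(\<lambda>k. (\<Sum>i\<in>J k. prob (A i)) / real k ^ 4) \<longlonglongrightarrow> c"
  shows "AE \<omega> in M. (\<lambda>k. (\<Sum>i\<in>J k. indicator (A i) \<omega>) / real k ^ 4) \<longlonglongrightarrow> c"
proof -
  define S :: "nat \<Rightarrow> 'a \<Rightarrow> real" where "S k \<omega> = (\<Sum>i\<in>J k. indicator (A i) \<omega>)" for k \<omega>
  define \<mu> where "\<mu> k = (\<Sum>i\<in>J k. prob (A i))" for k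
  have ev [measurable]: "A i \<in> events" if "i \<in> J k" for i k
    using indep that J(2)[of k] by (auto simp: indep_events_def)
  have [measurable]: "S k \<in> borel_measurable M" for k
    unfolding S_def by measurable
  have int2: "integrable M (\<lambda>\<omega>. (S k \<omega>)\<^sup>2)" for k
  proof (rule integrable_const_bound)
    show "AE \<omega> in M. norm ((S k \<omega>)\<^sup>2) \<le> (\<Sum>i\<in>J k. 1)\<^sup>2"
      unfolding S_def by (intro AE_I2)
        (auto intro!: power_mono sum_mono sum_nonneg indicator_le_1 simp del: sum_constant)
  qed measurable
  have ES: "expectation (S k) = \<mu> k" for k
    unfolding S_def \<mu>_def by (subst Bochner_Integration.integral_sum) (auto simp: emeasure_eq_measure)
  have "indep_events A (J k)" for k
  proof (rule indep_eventsI)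
    show "prob (\<Inter>i\<in>L. A i) = (\<Prod>i\<in>L. prob (A i))" if "L \<subseteq> J k" "finite L" "L \<noteq> {}" for L
      by (rule indep_events_def[THEN iffD1, THEN conjunct2, rule_format, OF indep])
        (use that J(2)[of k] in auto)
  qed (rule ev)
  then have var: "variance (S k) \<le> \<mu> k" for k
    unfolding S_def \<mu>_def using J(1) by (rule variance_count_le)
  define D where "D k = {\<omega>\<in>space M. \<bar>S k \<omega> - \<mu> k\<bar> \<ge> real k ^ 3}" for k
  have D_meas [measurable]: "D k \<in> events" for k
    unfolding D_def by measurable
  have "eventually (\<lambda>k. \<mu> k / real k ^ 4 < c + 1) sequentially"
    using mean unfolding \<mu>_def by (rule order_tendstoD) simp
  then have "eventually (\<lambda>k. norm (prob (D k)) \<le> (c + 1) * (1 / real k ^ 2)) sequentially"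
    using eventually_gt_at_top[of 0]
  proof eventually_elim
    case (elim k)
    have "prob (D k) \<le> variance (S k) / (real k ^ 3)\<^sup>2"
      using Chebyshev_inequality[of "S k" "real k ^ 3"] int2 elim by (simp add: D_def ES)
    also have "\<dots> \<le> \<mu> k / (real k ^ 3)\<^sup>2"
      using var by (intro divide_right_mono) auto
    also have "\<dots> = \<mu> k / real k ^ 4 * (1 / real k ^ 2)"
      using elim by (simp add: field_simps flip: power_mult power_add)
    also have "\<dots> \<le> (c + 1) * (1 / real k ^ 2)"
      using elim by (intro mult_right_mono) auto
    finally show ?case by simp
  qed
  then have "summable (\<lambda>k. prob (D k))"
    by (rule summable_comparison_test_ev)
      (intro summable_mult, use inverse_power_summable[of 2, where ?'a = real] in \<open>simp add: inverse_eq_divide\<close>)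
  then have "AE \<omega> in M. eventually (\<lambda>k. \<omega> \<in> space M - D k) sequentially"
    by (intro borel_cantelli_AE1) (auto simp: emeasure_eq_measure)
  then show ?thesis
  proof eventually_elim
    case (elim \<omega>)
    have "(\<lambda>k. S k \<omega> / real k ^ 4 - \<mu> k / real k ^ 4) \<longlonglongrightarrow> 0"
    proof (rule Lim_null_comparison)
      show "eventually (\<lambda>k. norm (S k \<omega> / real k ^ 4 - \<mu> k / real k ^ 4) \<le> 1 / real k) sequentially"
        using elim eventually_gt_at_top[of 0]
      proof eventually_elim
        case (elim k)
        then have "\<bar>S k \<omega> - \<mu> k\<bar> \<le> real k ^ 3"
          by (auto simp: D_def)
        then have "\<bar>S k \<omega> - \<mu> k\<bar> / real k ^ 4 \<le> real k ^ 3 / real k ^ 4"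
          by (intro divide_right_mono) auto
        also have "\<dots> = 1 / real k"
          using elim by (simp add: field_simps eval_nat_numeral)
        finally show ?case
          by (simp flip: diff_divide_distrib)
      qed
    qed (rule lim_1_over_n)
    from tendsto_add[OF this mean[folded \<mu>_def]] show ?case
      by (simp add: S_def)
  qed
qed

section \<open>Passage to the limit along all integers\<close>

text \<open>
  With \<open>k\<close> the integer part of the fourth root of \<open>log 10 n\<close>, the integer \<open>n\<close> lies between the
  consecutive thresholds \<open>10 ^ k ^ 4\<close> and \<open>10 ^ Suc k ^ 4\<close>. Monotonicity of \<open>f\<close> then encloses
  \<open>f n / log 10 n\<close> between the values of the given quotient at \<open>k\<close> and at \<open>Suc k\<close>, up to factors
  tending to 1.
\<close>
lemma mono_div_log_tendsto:
  fixes f :: "nat \<Rightarrow> real"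
  assumes "mono f" and nonneg: "\<And>n. 0 \<le> f n"
    and lim: "(\<lambda>k. f (10 ^ k ^ 4) / real k ^ 4) \<longlonglongrightarrow> c"
  shows "(\<lambda>n. f n / log 10 (real n)) \<longlonglongrightarrow> c"
proof -
  define u where "u k = f (10 ^ k ^ 4) / real k ^ 4" for k
  define \<kappa> where "\<kappa> n = nat \<lfloor>root 4 (log 10 (real n))\<rfloor>" for n
  have \<kappa>: "filterlim \<kappa> at_top sequentially"
  proof -
    have "filterlim (\<lambda>n. log 10 (real n)) at_top sequentially"
      by real_asymp
    moreover have "filterlim (\<lambda>x::real. nat \<lfloor>root 4 x\<rfloor>) at_top at_top"
      by real_asymp
    ultimately show ?thesis
      unfolding \<kappa>_def by (rule filterlim_compose[rotated])
  qed
  have ratio: "(\<lambda>k. (real k / real (Suc k)) ^ 4) \<longlonglongrightarrow> 1" "(\<lambda>k. (real (Suc k) / real k) ^ 4) \<longlonglongrightarrow> 1"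
    by real_asymp+
  have bounds: "eventually (\<lambda>n. u (\<kappa> n) * (real (\<kappa> n) / real (Suc (\<kappa> n))) ^ 4 \<le> f n / log 10 (real n) \<and>
      f n / log 10 (real n) \<le> u (Suc (\<kappa> n)) * (real (Suc (\<kappa> n)) / real (\<kappa> n)) ^ 4) sequentially"
    using eventually_ge_at_top[of 10]
  proof eventually_elim
    case (elim n)
    define L where "L = log 10 (real n)"
    define k where "k = \<kappa> n"
    have L: "L \<ge> 1"
      using elim by (simp add: L_def le_log_iff)
    then have "1 \<le> root 4 L"
      by simp
    then have k: "real k \<le> root 4 L" "root 4 L < real (Suc k)" "k \<ge> 1"
      unfolding k_def \<kappa>_def L_def[symmetric] by linarith+
    have root: "root 4 L ^ 4 = L"
      using L by simp
    have kL: "real k ^ 4 \<le> L" "L \<le> real (Suc k) ^ 4"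
      using power_mono[OF k(1), of 4] power_mono[of "root 4 L" "real (Suc k)" 4] k(2) L
      unfolding root by auto
    have n: "real n = 10 powr L"
      using elim by (simp add: L_def)
    have "real (10 ^ m ^ 4) = 10 powr (real m ^ 4)" for m
      using powr_realpow[of 10 "m ^ 4"] by simp
    then have "real (10 ^ k ^ 4) \<le> real n" "real n \<le> real (10 ^ Suc k ^ 4)"
      unfolding n using kL by (simp_all only: powr_le_cancel_iff)
    then have "10 ^ k ^ 4 \<le> n" "n \<le> 10 ^ Suc k ^ 4"
      by (simp_all only: of_nat_le_iff)
    then have f: "f (10 ^ k ^ 4) \<le> f n" "f n \<le> f (10 ^ Suc k ^ 4)"
      using \<open>mono f\<close> by (auto dest: monoD)
    have "f (10 ^ k ^ 4) / real (Suc k) ^ 4 \<le> f n / L" "f n / L \<le> f (10 ^ Suc k ^ 4) / real k ^ 4"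
      using f kL k L nonneg by (auto intro!: frac_le)
    moreover have "u k * (real k / real (Suc k)) ^ 4 = f (10 ^ k ^ 4) / real (Suc k) ^ 4"
      "u (Suc k) * (real (Suc k) / real k) ^ 4 = f (10 ^ Suc k ^ 4) / real k ^ 4"
      using k(3) by (simp_all add: u_def power_divide del: of_nat_Suc)
    ultimately show ?case
      unfolding L_def k_def by presburger
  qed
  have lim1: "(\<lambda>k. u k * (real k / real (Suc k)) ^ 4) \<longlonglongrightarrow> c"
    using tendsto_mult[OF lim ratio(1)] by (simp add: u_def)
  have lim2: "(\<lambda>k. u (Suc k) * (real (Suc k) / real k) ^ 4) \<longlonglongrightarrow> c"
    using tendsto_mult[OF LIMSEQ_Suc[OF lim] ratio(2)] unfolding u_def by simp
  show ?thesis
    by (rule real_tendsto_sandwich[OF _ _ filterlim_compose[OF lim1 \<kappa>] filterlim_compose[OF lim2 \<kappa>]])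
      (rule eventually_mono[OF bounds], blast)+
qed

lemma cesaro_mean_tendsto:
  fixes d :: "nat \<Rightarrow> real"
  assumes "d \<longlonglongrightarrow> c"
  shows "(\<lambda>n. (\<Sum>j<n. d j) / real n) \<longlonglongrightarrow> c"
proof -
  have "(\<lambda>n. (\<Sum>j<n. d j - c) / real n) \<longlonglongrightarrow> 0"
  proof (rule LIMSEQ_I)
    fix e :: real assume "e > 0"
    with LIMSEQ_D[OF assms, of "e / 2"] obtain N where N: "\<And>j. j \<ge> N \<Longrightarrow> \<bar>d j - c\<bar> < e / 2"
      by (auto simp: real_norm_def)
    define K where "K = (\<Sum>j<N. \<bar>d j - c\<bar>)"
    have "(\<lambda>n. K / real n) \<longlonglongrightarrow> 0"
      by (rule lim_const_over_n)
    then have "eventually (\<lambda>n. K / real n < e / 2) sequentially"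
      by (rule order_tendstoD) (use \<open>e > 0\<close> in simp)
    then have "eventually (\<lambda>n. norm ((\<Sum>j<n. d j - c) / real n - 0) < e) sequentially"
      using eventually_ge_at_top[of "Suc N"]
    proof eventually_elim
      case (elim n)
      have "\<bar>\<Sum>j<n. d j - c\<bar> \<le> (\<Sum>j<n. \<bar>d j - c\<bar>)"
        by (rule sum_abs)
      also have "\<dots> = K + (\<Sum>j\<in>{N..<n}. \<bar>d j - c\<bar>)"
        using elim unfolding K_def lessThan_atLeast0 by (subst sum.atLeastLessThan_concat) auto
      also have "(\<Sum>j\<in>{N..<n}. \<bar>d j - c\<bar>) \<le> (\<Sum>j\<in>{N..<n}. e / 2)"
        using N by (intro sum_mono) (auto intro: less_imp_le)
      also have "\<dots> \<le> real n * (e / 2)"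
        using \<open>e > 0\<close> by (simp add: mult_right_mono)
      finally have "\<bar>\<Sum>j<n. d j - c\<bar> / real n \<le> (K + real n * (e / 2)) / real n"
        by (intro divide_right_mono) auto
      also have "\<dots> = K / real n + e / 2"
        using elim by (simp add: add_divide_distrib)
      finally have "\<bar>\<Sum>j<n. d j - c\<bar> / real n < e"
        using elim(1) by linarith
      then show ?case
        by (simp add: abs_divide)
    qed
    then show "\<exists>no. \<forall>n\<ge>no. norm ((\<Sum>j<n. d j - c) / real n - 0) < e"
      by (simp add: eventually_sequentially)
  qed
  then have "(\<lambda>n. (\<Sum>j<n. d j - c) / real n + c) \<longlonglongrightarrow> 0 + c"
    by (intro tendsto_intros)
  then have "(\<lambda>n. (\<Sum>j<n. d j - c) / real n + c) \<longlonglongrightarrow> c"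
    by simp
  moreover have "eventually (\<lambda>n. (\<Sum>j<n. d j - c) / real n + c = (\<Sum>j<n. d j) / real n) sequentially"
    using eventually_gt_at_top[of 0] by eventually_elim (simp add: sum_subtractf field_simps)
  ultimately show ?thesis
    by (rule Lim_transform_eventually)
qed

section \<open>Logarithmic density of the mantissa sets\<close>

text \<open>
  The content is that the description in the definition of the mantissa is unique: changing the
  exponent changes the factor in front by at least a factor of 10.
\<close>
lemma mantissa_eq:
  fixes m :: real
  assumes "1 \<le> m" "m < 10"
  shows "mantissa (m * 10 powi k) = m"
proof -
  have no: False if "1 \<le> a" "a < 10" "1 \<le> b" "i < j" "a * 10 powi i = b * 10 powi j"
    for a b :: real and i j :: int
  proof -
    have "(10::real) powi j = 10 powi i * 10 powi (j - i)"
      by (simp flip: power_int_add)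
    with that have "a = b * 10 powi (j - i)"
      by simp
    moreover have "(10::real) powi 1 \<le> 10 powi (j - i)"
      using that by (intro power_int_increasing) auto
    ultimately have "10 \<le> a"
      using that mult_mono[of 1 b 10 "10 powi (j - i)"] by simp
    with that show False by simp
  qed
  show ?thesis
    unfolding mantissa_def
  proof (rule the_equality)
    fix m' :: real
    assume m': "1 \<le> m' \<and> m' < 10 \<and> (\<exists>k'::int. m * 10 powi k = m' * 10 powi k')"
    then obtain k' where k': "m * 10 powi k = m' * 10 powi k'" by blast
    have "k = k'"
      using no[of m m' k k'] no[of m' m k' k] assms m' k' by (cases k k' rule: linorder_cases) auto
    with k' show "m' = m" by simp
  qed (use assms in auto)
qed

lemma mantissa_less_iff_decade:
  assumes "n \<in> {10 ^ j..<10 ^ Suc j}"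
  shows "mantissa (real n) < t \<longleftrightarrow> real n < t * 10 ^ j"
proof -
  have "real (10 ^ j) \<le> real n" "real n < real (10 ^ Suc j)"
    using assms by (simp_all only: of_nat_le_iff of_nat_less_iff atLeastLessThan_iff)
  then have "mantissa (real n / 10 ^ j * 10 powi int j) = real n / 10 ^ j"
    by (intro mantissa_eq) (auto simp: field_simps)
  then have "mantissa (real n) = real n / 10 ^ j"
    by simp
  then show ?thesis
    by (simp add: pos_divide_less_eq)
qed

definition mantissa_less :: "real \<Rightarrow> nat set" where
  "mantissa_less t = {n. n \<ge> 1 \<and> mantissa (real n) < t}"

lemma mantissa_less_decade:
  assumes "1 \<le> t" "t \<le> 10"
  shows "mantissa_less t \<inter> {10 ^ j..<10 ^ Suc j} = {10 ^ j..<nat \<lceil>t * 10 ^ j\<rceil>}"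
proof -
  define N where "N = nat \<lceil>t * 10 ^ j\<rceil>"
  have le: "N \<le> 10 ^ Suc j"
    using assms by (simp add: N_def ceiling_le_iff)
  have less_N: "real n < t * 10 ^ j \<longleftrightarrow> n < N" for n
    unfolding N_def by linarith
  show ?thesis
    unfolding N_def[symmetric]
  proof (rule set_eqI)
    fix n
    show "n \<in> mantissa_less t \<inter> {10 ^ j..<10 ^ Suc j} \<longleftrightarrow> n \<in> {10 ^ j..<N}"
    proof (cases "n \<in> {10 ^ j..<10 ^ Suc j}")
      case True
      moreover from this have "n \<ge> 1"
        using one_le_power[of "10::nat" j] by simp
      ultimately show ?thesis
        by (simp add: mantissa_less_def mantissa_less_iff_decade[OF True] less_N)
    next
      case False
      with le show ?thesis by auto
    qed
  qed
qed

lemma mantissa_less_10: "mantissa_less 10 = {1..}"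
proof -
  have "n \<in> mantissa_less 10" if "n \<ge> 1" for n
  proof -
    from ex_power_ivl1[of 10 n] that obtain j where "10 ^ j \<le> n" "n < 10 ^ (j + 1)" by auto
    then have "n \<in> {10 ^ j..<10 ^ Suc j}" by simp
    moreover from this have "real n < real (10 ^ Suc j)"
      by (simp only: of_nat_less_iff atLeastLessThan_iff)
    ultimately show ?thesis
      using that by (auto simp: mantissa_less_def mantissa_less_iff_decade simp del: atLeastLessThan_iff)
  qed
  then show ?thesis by (auto simp: mantissa_less_def)
qed

text \<open>
  The sum over a decade is a difference of harmonic numbers, and
  \<open>harm n - ln n\<close> converges; so in the limit only the logarithm of the ratio of
  the end points of the interval remains, and this ratio tends to \<open>t\<close>.
\<close>
lemma decade_reciprocal_sum_tendsto:
  assumes t: "1 \<le> t" "t \<le> 10"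
  shows "(\<lambda>j. \<Sum>n\<in>mantissa_less t \<inter> {10 ^ j..<10 ^ Suc j}. 1 / real n) \<longlonglongrightarrow> ln t"
proof -
  \<comment> \<open>\<open>p j\<close> is the last integer before the interval, \<open>q j\<close> its last element.\<close>
  define p q where "p j = 10 ^ j - (1::nat)" and "q j = nat \<lceil>t * 10 ^ j\<rceil> - 1" for j
  define \<gamma> where "\<gamma> n = harm n - ln (real n)" for n
  have decade_le: "10 ^ j \<le> nat \<lceil>t * 10 ^ j\<rceil>" for j
  proof -
    have "real (10 ^ j) \<le> t * 10 ^ j" using t by simp
    then show ?thesis by linarith
  qed
  then have pq: "p j \<le> q j" for j
    unfolding p_def q_def by (rule diff_le_mono)
  have p_top: "filterlim p at_top sequentially"
    unfolding p_def by real_asymp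
  have q_top: "filterlim q at_top sequentially"
    using p_top by (rule filterlim_at_top_mono) (simp add: pq)
  have sum: "(\<Sum>n\<in>mantissa_less t \<inter> {10 ^ j..<10 ^ Suc j}. 1 / real n) = harm (q j) - harm (p j)" for j
  proof -
    have "{10 ^ j..<nat \<lceil>t * 10 ^ j\<rceil>} = {Suc (p j)..q j}"
    proof -
      have "{a..<b} = {Suc (a - 1)..b - 1}" if "0 < a" "a \<le> b" for a b :: nat
        using that by auto
      then show ?thesis
        unfolding p_def q_def using decade_le by simp
    qed
    moreover have "harm (q j) = harm (p j) + (\<Sum>n\<in>{Suc (p j)..q j}. 1 / real n)"
    proof -
      have "{1..q j} = {1..p j} \<union> {Suc (p j)..q j}" using pq[of j] by auto
      then show ?thesis
        by (simp add: harm_def sum.union_disjoint inverse_eq_divide)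
    qed
    ultimately show ?thesis
      by (simp only: mantissa_less_decade[OF t] add_diff_cancel_left')
  qed
  \<comment> \<open>Rounding moves the end points by at most 1, so the ratio is squeezed to \<open>t\<close>.\<close>
  have "(\<lambda>j. real (q j) / real (p j)) \<longlonglongrightarrow> t"
  proof (rule real_tendsto_sandwich)
    have pos: "real (p j) > 0" if "j \<ge> 1" for j
      using that one_less_power[of "10::nat" j] by (simp add: p_def)
    have rp: "real (p j) = 10 ^ j - 1" for j
      by (simp add: p_def of_nat_diff)
    have qb: "t * 10 ^ j - 1 \<le> real (q j)" "real (q j) \<le> t * 10 ^ j" for j
    proof -
      have "0 \<le> t * 10 ^ j" using t by simp
      then show "t * 10 ^ j - 1 \<le> real (q j)" "real (q j) \<le> t * 10 ^ j"
        unfolding q_def by linarith+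
    qed
    show "eventually (\<lambda>j. (t * 10 ^ j - 1) / (10 ^ j - 1) \<le> real (q j) / real (p j)) sequentially"
      using eventually_ge_at_top[of 1]
      by eventually_elim (use qb pos in \<open>simp add: divide_right_mono flip: rp\<close>)
    show "eventually (\<lambda>j. real (q j) / real (p j) \<le> t * 10 ^ j / (10 ^ j - 1)) sequentially"
      using eventually_ge_at_top[of 1]
      by eventually_elim (use qb pos in \<open>simp add: divide_right_mono flip: rp\<close>)
    show "(\<lambda>j. (t * 10 ^ j - 1) / (10 ^ j - 1)) \<longlonglongrightarrow> t" "(\<lambda>j. t * 10 ^ j / (10 ^ j - 1)) \<longlonglongrightarrow> t"
      using t by real_asymp+
  qed
  then have ln_ratio: "(\<lambda>j. ln (real (q j) / real (p j))) \<longlonglongrightarrow> ln t"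
    using t by (intro tendsto_ln) auto
  have \<gamma>: "\<gamma> \<longlonglongrightarrow> euler_mascheroni"
    unfolding \<gamma>_def by (rule euler_mascheroni_LIMSEQ)
  have "(\<lambda>j. \<gamma> (q j) - \<gamma> (p j) + ln (real (q j) / real (p j))) \<longlonglongrightarrow>
      euler_mascheroni - euler_mascheroni + ln t"
    by (intro tendsto_add tendsto_diff ln_ratio filterlim_compose[OF \<gamma>] p_top q_top)
  then have "(\<lambda>j. \<gamma> (q j) - \<gamma> (p j) + ln (real (q j) / real (p j))) \<longlonglongrightarrow> ln t"
    by simp
  moreover have "eventually (\<lambda>j. \<gamma> (q j) - \<gamma> (p j) + ln (real (q j) / real (p j)) =
      (\<Sum>n\<in>mantissa_less t \<inter> {10 ^ j..<10 ^ Suc j}. 1 / real n)) sequentially"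
    using eventually_compose_filterlim[OF eventually_gt_at_top[of 0] p_top]
      eventually_compose_filterlim[OF eventually_gt_at_top[of 0] q_top]
    by eventually_elim (simp add: sum \<gamma>_def ln_div del: power_Suc)
  ultimately show ?thesis
    by (rule Lim_transform_eventually)
qed

text \<open>
  Cutting the sum into decades turns the quotient into a Cesaro mean of the decade sums.
\<close>
lemma mantissa_less_log_density:
  assumes t: "1 \<le> t" "t \<le> 10"
  shows "(\<lambda>k. (\<Sum>n\<in>mantissa_less t \<inter> {..<10 ^ k}. 1 / real n) / real k) \<longlonglongrightarrow> ln t"
proof -
  have "(\<Sum>n\<in>mantissa_less t \<inter> {..<10 ^ k}. 1 / real n) =
      (\<Sum>j<k. \<Sum>n\<in>mantissa_less t \<inter> {10 ^ j..<10 ^ Suc j}. 1 / real n)" for k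
  proof (induction k)
    case 0
    then show ?case by (auto simp: mantissa_less_def)
  next
    case (Suc k)
    have "mantissa_less t \<inter> {..<10 ^ Suc k} =
        (mantissa_less t \<inter> {..<10 ^ k}) \<union> (mantissa_less t \<inter> {10 ^ k..<10 ^ Suc k})"
      by auto
    then show ?case
      using Suc.IH by (simp add: sum.union_disjoint disjoint_iff del: power_Suc)
  qed
  with cesaro_mean_tendsto[OF decade_reciprocal_sum_tendsto[OF t]] show ?thesis
    by simp
qed

section \<open>Counting the elements of a URI-set\<close>

text \<open>
  The strong law for a URI-set: if the mean number of elements of \<open>B\<close> per decade is
  asymptotically \<open>c\<close>, so is almost surely the actual number. The hypothesis speaks of powers of 10,
  among which the thresholds \<open>10 ^ k ^ 4\<close> of the strong law along a subsequence are found.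
\<close>
lemma (in URI_set) AE_card_div_log_tendsto:
  assumes B: "B \<subseteq> {1..}"
    and dens: "(\<lambda>k. (\<Sum>n\<in>B \<inter> {..<10 ^ k}. 1 / real n) / real k) \<longlonglongrightarrow> c"
  shows "AE \<omega> in M. (\<lambda>n. real (card (E \<omega> \<inter> B \<inter> {..<n})) / log 10 (real n)) \<longlonglongrightarrow> c"
proof -
  define A where "A n = {\<omega> \<in> space M. n \<in> E \<omega>}" for n
  have "(\<lambda>k. (\<Sum>n\<in>B \<inter> {..<10 ^ k ^ 4}. 1 / real n) / real (k ^ 4)) \<longlonglongrightarrow> c"
    by (rule filterlim_compose[OF dens]) real_asymp
  moreover have "(\<Sum>n\<in>B \<inter> {..<m}. prob (A n)) = (\<Sum>n\<in>B \<inter> {..<m}. 1 / real n)" for m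
    using B by (intro sum.cong) (auto simp: A_def prob_mem)
  ultimately have "(\<lambda>k. (\<Sum>n\<in>B \<inter> {..<10 ^ k ^ 4}. prob (A n)) / real k ^ 4) \<longlonglongrightarrow> c"
    by simp
  then have "AE \<omega> in M. (\<lambda>k. (\<Sum>n\<in>B \<inter> {..<10 ^ k ^ 4}. indicator (A n) \<omega>) / real k ^ 4) \<longlonglongrightarrow> c"
    using B indep_mem[folded A_def] by (intro AE_count_div_power4_tendsto) auto
  then show ?thesis
    using AE_space
  proof eventually_elim
    case (elim \<omega>)
    have card: "(\<Sum>n\<in>B \<inter> {..<m}. indicator (A n) \<omega>) = real (card (E \<omega> \<inter> B \<inter> {..<m}))" for m
    proof -
      have "(\<Sum>n\<in>B \<inter> {..<m}. indicator (A n) \<omega>) = (\<Sum>n\<in>B \<inter> {..<m}. indicator (E \<omega>) n :: real)"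
        using elim by (intro sum.cong) (auto simp: A_def indicator_def)
      also have "\<dots> = real (card ((B \<inter> {..<m}) \<inter> E \<omega>))"
        by (simp add: indicator_def sum_of_bool_eq)
      finally show ?thesis
        by (simp add: Int_ac)
    qed
    show ?case
    proof (rule mono_div_log_tendsto)
      show "mono (\<lambda>n. real (card (E \<omega> \<inter> B \<inter> {..<n})))"
        by (auto intro!: monoI card_mono)
      show "(\<lambda>k. real (card (E \<omega> \<inter> B \<inter> {..<10 ^ k ^ 4})) / real k ^ 4) \<longlonglongrightarrow> c"
        using elim(1) unfolding card .
    qed simp
  qed
qed

lemma enumerate_image_lessThan:
  fixes S :: "nat set"
  assumes "infinite S"
  shows "enumerate S ` {..<n} = S \<inter> {..<enumerate S n}"
proof (intro equalityI subsetI)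
  fix s assume s: "s \<in> S \<inter> {..<enumerate S n}"
  with enumerate_Ex[of S s] obtain k where "s = enumerate S k"
    using assms by auto
  with s assms show "s \<in> enumerate S ` {..<n}" by auto
qed (use assms enumerate_in_set in auto)

text \<open>
  Exactly \<open>n\<close> elements of \<open>S\<close> lie strictly below \<open>enumerate S n\<close>, because \<^const>\<open>enumerate\<close>
  counts from 0. Thus the average over the first \<open>n\<close> elements is the quotient in the hypothesis
  at this argument, which tends to infinity.
\<close>
lemma average_nth_elem_tendsto:
  fixes S A :: "nat set"
  assumes S: "infinite S"
    and lim: "(\<lambda>n. real (card (S \<inter> A \<inter> {..<n})) / real (card (S \<inter> {..<n}))) \<longlonglongrightarrow> \<alpha>"
  shows "(\<lambda>n. (1 / real n) * (\<Sum>k=1..n. indicator A (nth_elem S k))) \<longlonglongrightarrow> \<alpha>"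
proof -
  have inj: "inj_on (enumerate S) T" for T
    using inj_enumerate[OF S] by (rule inj_on_subset) simp
  have "card (S \<inter> {..<enumerate S n}) = n" for n
    unfolding enumerate_image_lessThan[OF S, symmetric] by (simp add: card_image inj)
  moreover have "(\<Sum>k=1..n. indicator A (nth_elem S k)) = real (card (S \<inter> A \<inter> {..<enumerate S n}))" for n
  proof -
    have "(\<Sum>k=1..n. indicator A (nth_elem S k) :: real) = (\<Sum>k<n. indicator A (enumerate S k))"
      by (rule sum.reindex_bij_witness[of _ Suc "\<lambda>k. k - 1"]) (auto simp: nth_elem_def)
    also have "\<dots> = (\<Sum>s\<in>enumerate S ` {..<n}. indicator A s)"
      by (simp add: sum.reindex inj)
    also have "\<dots> = (\<Sum>s\<in>S \<inter> {..<enumerate S n}. indicator A s)"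
      by (simp only: enumerate_image_lessThan[OF S])
    also have "\<dots> = real (card (S \<inter> {..<enumerate S n} \<inter> A))"
      by (simp add: indicator_def sum_of_bool_eq)
    finally show ?thesis
      by (simp add: Int_ac)
  qed
  moreover have "filterlim (enumerate S) at_top sequentially"
    using filterlim_ident by (rule filterlim_at_top_mono) (simp add: le_enumerate S)
  ultimately show ?thesis
    using filterlim_compose[OF lim, of "enumerate S"] by simp
qed

theorem theorem3p5:
  fixes M :: "'w measure" and E :: "'w \<Rightarrow> nat set" and t :: real
  assumes "URI_set M E"
    and "1 \<le> t" and "t \<le> 10"
  shows "has_URI_density M E {n::nat. n \<ge> 1 \<and> mantissa (real n) < t} (log 10 t)"
proof -
  interpret URI_set M E by fact
  define C where "C B \<omega> n = real (card (E \<omega> \<inter> B \<inter> {..<n}))" for B \<omega> n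
  have count: "AE \<omega> in M. (\<lambda>n. C (mantissa_less s) \<omega> n / log 10 (real n)) \<longlonglongrightarrow> ln s"
    if "1 \<le> s" "s \<le> 10" for s
    unfolding C_def using that
    by (intro AE_card_div_log_tendsto mantissa_less_log_density) (auto simp: mantissa_less_def)
  have "AE \<omega> in M. (\<lambda>n. (1 / real n) * (\<Sum>k=1..n. indicator (mantissa_less t) (nth_elem (E \<omega>) k)))
      \<longlonglongrightarrow> log 10 t"
    using count[OF assms(2,3)] count[of 10, simplified] AE_space
  proof eventually_elim
    case (elim \<omega>)
    have E: "E \<omega> \<inter> {1..} = E \<omega>"
      using positive[OF elim(3)] by auto
    have lim: "(\<lambda>n. C UNIV \<omega> n / log 10 (real n)) \<longlonglongrightarrow> ln 10"
      using elim(2) unfolding C_def mantissa_less_10 E by simp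
    have top: "filterlim (\<lambda>n. log 10 (real n)) at_top sequentially"
      by real_asymp
    show ?case
    proof (rule average_nth_elem_tendsto)
      \<comment> \<open>A bounded count could not grow like \<open>ln 10 * log 10 n\<close>.\<close>
      show "infinite (E \<omega>)"
      proof
        assume fin: "finite (E \<omega>)"
        have "(\<lambda>n. C UNIV \<omega> n / log 10 (real n)) \<longlonglongrightarrow> 0"
        proof (rule Lim_null_comparison)
          show "(\<lambda>n. real (card (E \<omega>)) / log 10 (real n)) \<longlonglongrightarrow> 0"
            using top by (intro tendsto_divide_0[OF tendsto_const] filterlim_at_top_imp_at_infinity)
          show "eventually (\<lambda>n. norm (C UNIV \<omega> n / log 10 (real n)) \<le>
              real (card (E \<omega>)) / log 10 (real n)) sequentially"
            using eventually_ge_at_top[of 1]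
            by eventually_elim (use fin in \<open>auto simp: C_def intro!: divide_right_mono card_mono\<close>)
        qed
        from LIMSEQ_unique[OF lim this] show False by simp
      qed
      have "(\<lambda>n. (C (mantissa_less t) \<omega> n / log 10 (real n)) / (C UNIV \<omega> n / log 10 (real n)))
          \<longlonglongrightarrow> ln t / ln 10"
        using elim(1) lim by (intro tendsto_divide) auto
      then have "(\<lambda>n. (C (mantissa_less t) \<omega> n / log 10 (real n)) / (C UNIV \<omega> n / log 10 (real n)))
          \<longlonglongrightarrow> log 10 t"
        by (simp add: log_def)
      moreover have "eventually (\<lambda>n. (C (mantissa_less t) \<omega> n / log 10 (real n)) / (C UNIV \<omega> n / log 10 (real n))
          = C (mantissa_less t) \<omega> n / C UNIV \<omega> n) sequentially"
        using eventually_gt_at_top[of 1]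
      proof eventually_elim
        case (elim n)
        then have "log 10 (real n) > 0" by simp
        then show ?case by simp
      qed
      ultimately show "(\<lambda>n. real (card (E \<omega> \<inter> mantissa_less t \<inter> {..<n})) / real (card (E \<omega> \<inter> {..<n})))
          \<longlonglongrightarrow> log 10 t"
        unfolding C_def Int_UNIV_right by (rule Lim_transform_eventually)
    qed
  qed
  then show ?thesis
    by (simp add: has_URI_density_def mantissa_less_def)
qed

end
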